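(* The 20 partitions $P_1,\dots,P_{20}$ form exactly eight equivalence classes, namely: Class 1: $\{P_1,P_{18}\}$. Class 2: $\{P_2,P_3,P_4,P_5,P_9,P_{10},P_{14},P_{15},P_{16},P_{17},P_{19},P_{20}\}$. Class 3: $\{P_6\}$. Class 4: $\{P_7\}$, and $P_7$ is equivalent to the standard partition. Class 5: $\{P_8\}$. Class 6: $\{P_{11}\}$. Class 7: $\{P_{12}\}$. Class 8: $\{P_{13}\}$.
   Context: A partition of the non-negative integers into three sets $A,B,C$ is considered together with enumerations without repetition $A=\{a_k\mid k\ge 1\}$, $B=\{b_k\mid k\ge 1\}$, $C=\{c_k\mid k\ge 1\}$ (not required to be increasing): every non-negative integer occurs exactly once among the $a_k,b_k,c_k$. The $k$-th column is $(a_k,b_k,c_k)$. Two partitions $A=\{a_k\},B=\{b_k\},C=\{c_k\}$ and $D=\{d_k\},E=\{e_k\},F=\{f_k\}$ ($k\ge 1$) of the non-negative integers are equivalent if there exists a number $N$ such that $a_k=d_k$, $b_k=e_k$ and $c_k=f_k$ for all $k>N$. The standard partition of the non-negative integers is given by the three sets, enumerated by $n\ge 1$, $$S_1=\{3n-\lfloor n/2\rfloor-2\mid n\ge 1\},\quad S_2=\{3n-\lfloor n/2\rfloor-1\mid n\ge 1\},\quad S_3=\{5n-5\mid n\ge 1\}.$$ Algorithm: given the first five columns, for $n=6,7,8,\dots$ successively, let $a_n<b_n$ be the two smallest non-negative integers not used in columns $1,\dots,n-1$, and let $c_n=S(n)-a_n-b_n$, where $S(n)=11n-2\lfloor n/2\rfloor-8$.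 The partitions $P_1,\dots,P_{20}$ are those produced by the algorithm from the following first five columns. In all cases column 1 is $(0,1,2)$ and column 2 is $(3,4,5)$. Columns 3, 4, 5 are: $P_1$: $(6,7,10),(8,9,15),(11,13,19)$ $P_2$: $(6,7,10),(8,9,15),(11,14,18)$ $P_3$: $(6,7,10),(8,9,15),(12,13,18)$ $P_4$: $(6,7,10),(8,9,15),(12,14,17)$ $P_5$: $(6,7,10),(8,9,15),(13,14,16)$ $P_6$: $(6,7,10),(8,11,13),(9,12,22)$ $P_7$: $(6,7,10),(8,11,13),(9,14,20)$ $P_8$: $(6,7,10),(8,11,13),(9,16,18)$ $P_9$: $(6,7,10),(8,11,13),(12,14,17)$ $P_{10}$: $(6,7,10),(8,11,13),(12,15,16)$ $P_{11}$: $(6,7,10),(9,11,12),(8,14,21)$ $P_{12}$: $(6,7,10),(9,11,12),(8,16,19)$ $P_{13}$: $(6,7,10),(9,11,12),(8,17,18)$ $P_{14}$: $(6,7,10),(9,11,12),(13,14,16)$ $P_{15}$: $(6,8,9),(7,11,14),(10,16,17)$ $P_{16}$: $(6,8,9),(7,11,14),(12,13,18)$ $P_{17}$: $(6,8,9),(7,11,14),(12,15,16)$ $P_{18}$: $(6,8,9),(7,12,13),(10,14,19)$ $P_{19}$: $(6,8,9),(7,12,13),(10,16,17)$ $P_{20}$: $(6,8,9),(7,12,13),(11,15,17)$ *)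

theory Defs
  imports Complex_Main
begin

text \<open>
  A sequence of columns: the \<open>k\<close>-th column is \<open>(a\<^sub>k, b\<^sub>k, c\<^sub>k)\<close>. Only the indices \<open>k \<ge> 1\<close>
  matter; the value at index \<open>0\<close> is junk and is ignored by every notion below.
  The entries are integers, not naturals, so that \<open>S(n) - a\<^sub>n - b\<^sub>n\<close> is a genuine difference.
\<close>

type_synonym column = "int \<times> int \<times> int"

fun entry_a :: "column \<Rightarrow> int" where "entry_a (a, b, c) = a"
fun entry_b :: "column \<Rightarrow> int" where "entry_b (a, b, c) = b"
fun entry_c :: "column \<Rightarrow> int" where "entry_c (a, b, c) = c"

definition entries :: "column \<Rightarrow> int set" where
  "entries x = {entry_a x, entry_b x, entry_c x}"

definition is_partition :: "(nat \<Rightarrow> column) \<Rightarrow> bool" where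
  "is_partition P \<longleftrightarrow>
    (let a = (\<lambda>k. entry_a (P k)); b = (\<lambda>k. entry_b (P k)); c = (\<lambda>k. entry_c (P k));
         A = a ` {1..}; B = b ` {1..}; C = c ` {1..}
     in inj_on a {1..} \<and> inj_on b {1..} \<and> inj_on c {1..} \<and>
        A \<inter> B = {} \<and> A \<inter> C = {} \<and> B \<inter> C = {} \<and>
        A \<union> B \<union> C = {0..})"

definition partition_equiv :: "((nat \<Rightarrow> column) \<times> (nat \<Rightarrow> column)) set" where
  "partition_equiv = {(P, Q). is_partition P \<and> is_partition Q \<and>
     (\<exists>N. \<forall>k>N. entry_a (P k) = entry_a (Q k) \<and> entry_b (P k) = entry_b (Q k)
                \<and> entry_c (P k) = entry_c (Q k))}"

definition standard_partition :: "nat \<Rightarrow> column" where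
  "standard_partition n =
     (3 * int n - \<lfloor>real n / 2\<rfloor> - 2, 3 * int n - \<lfloor>real n / 2\<rfloor> - 1, 5 * int n - 5)"

definition S :: "nat \<Rightarrow> int" where
  "S n = 11 * int n - 2 * \<lfloor>real n / 2\<rfloor> - 8"

definition least_unused :: "int set \<Rightarrow> int" where
  "least_unused U = (LEAST x. 0 \<le> x \<and> x \<notin> U)"

definition next_column :: "nat \<Rightarrow> int set \<Rightarrow> column" where
  "next_column n U =
     (let a = least_unused U; b = least_unused (insert a U) in (a, b, S n - a - b))"

text \<open>The list \<open>cs\<close> holds columns 1 to 5, so column \<open>n\<close> is \<open>cs ! (n - 1)\<close> for \<open>1 \<le> n \<le> 5\<close>.\<close>

function algorithm :: "column list \<Rightarrow> nat \<Rightarrow> column" where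
  "algorithm cs n =
     (if n \<le> 5 then cs ! (n - 1)
      else next_column n (\<Union>x \<in> algorithm cs ` {1..<n}. entries x))"
  by pat_completeness auto
termination
  by (relation "measure snd") auto

declare algorithm.simps [simp del]

definition columns_3_4_5 :: "column list list" where
  "columns_3_4_5 =
    [[(6,7,10), (8,9,15), (11,13,19)],
     [(6,7,10), (8,9,15), (11,14,18)],
     [(6,7,10), (8,9,15), (12,13,18)],
     [(6,7,10), (8,9,15), (12,14,17)],
     [(6,7,10), (8,9,15), (13,14,16)],
     [(6,7,10), (8,11,13), (9,12,22)],
     [(6,7,10), (8,11,13), (9,14,20)],
     [(6,7,10), (8,11,13), (9,16,18)],
     [(6,7,10), (8,11,13), (12,14,17)],
     [(6,7,10), (8,11,13), (12,15,16)],
     [(6,7,10), (9,11,12), (8,14,21)],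
     [(6,7,10), (9,11,12), (8,16,19)],
     [(6,7,10), (9,11,12), (8,17,18)],
     [(6,7,10), (9,11,12), (13,14,16)],
     [(6,8,9), (7,11,14), (10,16,17)],
     [(6,8,9), (7,11,14), (12,13,18)],
     [(6,8,9), (7,11,14), (12,15,16)],
     [(6,8,9), (7,12,13), (10,14,19)],
     [(6,8,9), (7,12,13), (10,16,17)],
     [(6,8,9), (7,12,13), (11,15,17)]]"

text \<open>\<open>P i\<close> is meaningful for \<open>1 \<le> i \<le> 20\<close> only.\<close>

definition P :: "nat \<Rightarrow> nat \<Rightarrow> column" where
  "P i = algorithm ([(0,1,2), (3,4,5)] @ columns_3_4_5 ! (i - 1))"

end

theory Submission
  imports Defs
begin

text \<open>
  In the standard partition \<open>c\<^sub>n = 5(n - 1)\<close>, and columns \<open>2m + 1\<close> and \<open>2m + 2\<close> share out the four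
  non-multiples of 5 between \<open>5m\<close> and \<open>5m + 5\<close>. If some \<open>c\<^bsub>m+1\<^esub>\<close> deviates from \<open>5m\<close> by a small
  amount \<open>d\<close>, then \<open>5m\<close> must be used in place of \<open>5m + d\<close>: in column \<open>2m + 1\<close> if \<open>d > 0\<close> and in
  column \<open>2m\<close> if \<open>d < 0\<close>. As the column sum is prescribed, that column's last entry deviates by \<open>d\<close>
  in turn. So deviations never interact and never die out, but move from \<open>m + 1\<close> to \<open>2m + 1\<close> or
  \<open>2m\<close>. Once all deviations with index in \<open>{m+1..2m}\<close> are at most 2, they determine the rest of the
  partition, and two partitions are equivalent iff their deviations agree there. All twenty
  partitions have reached that regime for \<open>m = 7\<close>, so only columns 8 to 14 need to be compared.
\<close>

definition used :: "(nat \<Rightarrow> column) \<Rightarrow> nat \<Rightarrow> int set" where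
  "used Q n = (\<Union>x \<in> Q ` {1..<n}. entries x)"

lemma used_Suc: "1 \<le> n \<Longrightarrow> used Q (Suc n) = used Q n \<union> entries (Q n)"
  by (auto simp: used_def atLeastLessThanSuc)

lemma S_eq: "S n = 11 * int n - 2 * (int n div 2) - 8"
  using floor_divide_of_nat_eq[of n 2, where 'a=real] by (simp add: S_def zdiv_int)

lemma S_odd: "S (2 * m + 1) = 20 * int m + 3"
  by (simp add: S_eq)

lemma S_even: "S (2 * m + 2) = 20 * int m + 12"
  by (simp add: S_eq)

lemma least_unused_eqI:
  assumes "0 \<le> x" "x \<notin> U" "\<And>y. 0 \<le> y \<Longrightarrow> y < x \<Longrightarrow> y \<in> U"
  shows "least_unused U = x"
  unfolding least_unused_def
  by (rule Least_equality) (use assms in \<open>auto simp: not_less[symmetric]\<close>)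

section \<open>Deviations and their passage through a pair of columns\<close>

definition dev :: "(nat \<Rightarrow> column) \<Rightarrow> nat \<Rightarrow> int" where
  "dev Q n = entry_c (Q n) - 5 * (int n - 1)"

text \<open>
  The clause on \<open>dev Q (2*m)\<close> records what \<open>dev Q (m+1)\<close> caused in the column just placed; without it
  a difference of two negative values of \<open>dev\<close> at \<open>m + 1\<close> could not be traced further.
\<close>

definition settled :: "(nat \<Rightarrow> column) \<Rightarrow> nat \<Rightarrow> bool" where
  "settled Q m \<longleftrightarrow> (\<forall>k\<in>{m<..2*m}. \<bar>dev Q k\<bar> \<le> 2) \<and> dev Q (2*m) = min 0 (dev Q (m+1)) \<and>
     used Q (2*m+1) = {0..<5 * int m} \<union> (if dev Q (m+1) < 0 then {5 * int m} else {})
       \<union> (\<lambda>k. entry_c (Q k)) ` {m<..2*m}"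

text \<open>The entry \<open>c\<close> at \<open>m+1\<close> is \<open>x + d\<close>. For
  \<open>d > 0\<close> it occupies \<open>x+1\<close> or \<open>x+2\<close>, and \<open>x\<close>
  stands in; for \<open>d < 0\<close> the number \<open>x\<close> is already used, which leaves the
  usual pair \<open>x+1\<close>, \<open>x+2\<close>.\<close>

definition odd_column :: "nat \<Rightarrow> int \<Rightarrow> column" where
  "odd_column m d = (let x = 5 * int m in
     if d \<le> 0 then (x+1, x+2, 2*x) else if d = 1 then (x, x+2, 2*x+1) else (x, x+1, 2*x+2))"

text \<open>Here \<open>d\<close> is the deviation at \<open>m+2\<close>, where the entry
  \<open>c\<close> is \<open>x + 5 + d\<close>. For \<open>d < 0\<close> it occupies
  \<open>x+4\<close> or \<open>x+3\<close>, and \<open>x+5\<close> stands in.\<close>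

definition even_column :: "nat \<Rightarrow> int \<Rightarrow> column" where
  "even_column m d = (let x = 5 * int m in
     if d \<ge> 0 then (x+3, x+4, 2*x+5) else if d = -1 then (x+3, x+5, 2*x+4) else (x+4, x+5, 2*x+3))"

text \<open>Only the entries \<open>c\<close> at \<open>m+1\<close> and \<open>m+2\<close> can
  disturb the choice among \<open>x..x+5\<close>; the first affects column \<open>2*m+1\<close>
  alone, the second column \<open>2*m+2\<close> alone. The deviations passed on are
  \<open>max 0 d\<close> and \<open>min 0 e\<close>, which keep the bound 2.\<close>

lemma settled_step:
  assumes st: "settled Q m" and m: "3 \<le> m"
    and odd: "Q (2*m+1) = next_column (2*m+1) (used Q (2*m+1))"
    and even: "Q (2*m+2) = next_column (2*m+2) (used Q (2*m+2))"
  shows "Q (2*m+1) = odd_column m (dev Q (m+1))"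
    and "Q (2*m+2) = even_column m (dev Q (m+2))"
    and "settled Q (m+1)"
proof -
  define x where "x = 5 * int m"
  define d e where "d = dev Q (m+1)" and "e = dev Q (m+2)"
  define R where "R = (\<lambda>k. entry_c (Q k)) ` {m+1<..2*m}"
  have x: "15 \<le> x" using m by (simp add: x_def)
  have dev2: "\<bar>dev Q k\<bar> \<le> 2" if "k \<in> {m<..2*m}" for k
    using st that by (simp add: settled_def)
  have d2: "\<bar>d\<bar> \<le> 2" and e2: "\<bar>e\<bar> \<le> 2"
    using dev2[of "m+1"] dev2[of "m+2"] m by (auto simp: d_def e_def)
  have interval: "{m<..2*m} = insert (m+1) {m+1<..2*m}" using m by auto
  have c1: "entry_c (Q (m+1)) = x + d" by (simp add: d_def dev_def x_def)
  have used1: "used Q (2*m+1) = {0..<x} \<union> (if d < 0 then {x} else {}) \<union> insert (x+d) R"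
    using st c1 unfolding settled_def interval by (simp add: R_def x_def d_def)
  have "entry_c (Q (m+2)) = x + 5 + e" by (simp add: e_def dev_def x_def)
  then have eR: "x + 5 + e \<in> R"
    unfolding R_def using m by (intro image_eqI[of _ _ "m+2"]) auto
  \<comment> \<open>From index \<open>m+3\<close> on, the entry \<open>c\<close> is at least
    \<open>5 * (m+2) - 2 = x + 8\<close>.\<close>
  have R: "y = x + 5 + e \<or> x + 8 \<le> y" if "y \<in> R" for y
  proof -
    from that obtain k where k: "k \<in> {m+1<..2*m}" "y = entry_c (Q k)" by (auto simp: R_def)
    show ?thesis
    proof (cases "k = m+2")
      case True then show ?thesis using k by (simp add: e_def dev_def x_def)
    next
      case False
      then show ?thesis using k dev2[of k] by (auto simp: dev_def x_def)
    qed
  qed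
  have Rlow: "y \<in> R \<longleftrightarrow> y = x + 5 + e" if "y \<le> x + 5" for y
    using R[of y] eR that by auto
  have "least_unused (used Q (2*m+1)) = (if d \<le> 0 then x+1 else x)"
    unfolding used1
    by (rule least_unused_eqI) (use x d2 e2 in \<open>auto simp: Rlow split: if_splits\<close>)
  moreover have "least_unused (insert (if d \<le> 0 then x+1 else x) (used Q (2*m+1)))
      = (if d = 2 then x+1 else x+2)"
    unfolding used1
    by (rule least_unused_eqI) (use x d2 e2 in \<open>auto simp: Rlow split: if_splits\<close>)
  ultimately show Qo: "Q (2*m+1) = odd_column m (dev Q (m+1))"
    unfolding d_def[symmetric] odd next_column_def odd_column_def Let_def S_odd x_def[symmetric]
    using d2 by (auto simp: x_def)
  have used2: "used Q (2*m+2) = {0..x+2} \<union> insert (2*x + max 0 d) R"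
  proof -
    have "used Q (2*m+2) = used Q (2*m+1) \<union> entries (Q (2*m+1))"
      using used_Suc[of "2*m+1" Q] by simp
    moreover have "entries (Q (2*m+1)) = (if d \<le> 0 then {x+1, x+2, 2*x}
        else if d = 1 then {x, x+2, 2*x+1} else {x, x+1, 2*x+2})"
      unfolding Qo by (simp add: odd_column_def entries_def Let_def x_def d_def)
    \<comment> \<open>For \<open>d > 0\<close> column \<open>2*m+1\<close> skips exactly
      \<open>x + d\<close>, which \<open>c\<close> at \<open>m+1\<close> supplies, so no gap remains
      below \<open>x + 3\<close>.\<close>
    moreover have "{0..<x} \<union> (if d < 0 then {x} else {}) \<union> insert (x+d) R \<union>
        (if d \<le> 0 then {x+1, x+2, 2*x} else if d = 1 then {x, x+2, 2*x+1} else {x, x+1, 2*x+2})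
      = {0..x+2} \<union> insert (2*x + max 0 d) R" (is "?A = ?B")
    proof (rule set_eqI)
      fix y show "y \<in> ?A \<longleftrightarrow> y \<in> ?B"
        by (cases "y \<in> R"; simp split: if_split; use d2 x in arith)
    qed
    ultimately show ?thesis by (simp only: used1)
  qed
  have "least_unused (used Q (2*m+2)) = (if e = -2 then x+4 else x+3)"
    unfolding used2
    by (rule least_unused_eqI) (use x d2 e2 in \<open>auto simp: Rlow split: if_splits\<close>)
  moreover have "least_unused (insert (if e = -2 then x+4 else x+3) (used Q (2*m+2)))
      = (if e < 0 then x+5 else x+4)"
    unfolding used2
    by (rule least_unused_eqI) (use x d2 e2 in \<open>auto simp: Rlow split: if_splits\<close>)
  ultimately show Qe: "Q (2*m+2) = even_column m (dev Q (m+2))"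
    unfolding e_def[symmetric] even next_column_def even_column_def Let_def S_even x_def[symmetric]
    using e2 by (auto simp: x_def)
  have devo: "dev Q (2*m+1) = max 0 d"
    unfolding dev_def[of _ "2*m+1"] Qo d_def[symmetric]
    using d2 by (auto simp: odd_column_def Let_def)
  have deve: "dev Q (2*m+2) = min 0 e"
    unfolding dev_def[of _ "2*m+2"] Qe e_def[symmetric]
    using e2 by (auto simp: even_column_def Let_def)
  have used3: "used Q (2*m+3) = {0..<x+5} \<union> (if e < 0 then {x+5} else {})
      \<union> insert (2*x + 5 + min 0 e) (insert (2*x + max 0 d) R)"
  proof -
    have "used Q (2*m+3) = used Q (2*m+2) \<union> entries (Q (2*m+2))"
      using used_Suc[of "2*m+2" Q] by (simp add: numeral_3_eq_3)
    moreover have "entries (Q (2*m+2)) = (if e \<ge> 0 then {x+3, x+4, 2*x+5}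
        else if e = -1 then {x+3, x+5, 2*x+4} else {x+4, x+5, 2*x+3})"
      unfolding Qe by (simp add: even_column_def entries_def Let_def x_def e_def)
    moreover have "{0..x+2} \<union> insert (2*x + max 0 d) R \<union>
        (if e \<ge> 0 then {x+3, x+4, 2*x+5} else if e = -1 then {x+3, x+5, 2*x+4}
         else {x+4, x+5, 2*x+3})
      = {0..<x+5} \<union> (if e < 0 then {x+5} else {})
      \<union> insert (2*x + 5 + min 0 e) (insert (2*x + max 0 d) R)" (is "?A = ?B")
    proof (rule set_eqI)
      fix y show "y \<in> ?A \<longleftrightarrow> y \<in> ?B"
      proof (cases "y = 2*x + max 0 d")
        case neq: False
        show ?thesis
        proof (cases "y \<in> R")
          case False
          \<comment> \<open>For \<open>e < 0\<close> the number that column \<open>2*m+2\<close>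
            skips is \<open>x + 5 + e\<close>, and this one lies in \<open>R\<close>.\<close>
          then have "y \<noteq> x + 5 + e" using eR by auto
          then show ?thesis
            using False neq by (simp split: if_split; use e2 x in arith)
        qed simp
      qed simp
    qed
    ultimately show ?thesis by (simp only: used2)
  qed
  have new: "{m+1<..2*(m+1)} = insert (2*m+2) (insert (2*m+1) {m+1<..2*m})" using m by auto
  show "settled Q (m+1)"
    unfolding settled_def
  proof (intro conjI ballI)
    fix k assume "k \<in> {m+1<..2*(m+1)}"
    then show "\<bar>dev Q k\<bar> \<le> 2"
      using devo deve d2 e2 dev2[of k] unfolding new by auto
  next
    show "dev Q (2*(m+1)) = min 0 (dev Q (m+1+1))" using deve by (simp add: e_def)
  next
    have co: "entry_c (Q (2*m+1)) = 2*x + max 0 d" using devo by (simp add: dev_def x_def)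
    have ce: "entry_c (Q (2*m+2)) = 2*x + 5 + min 0 e" using deve by (simp add: dev_def x_def)
    show "used Q (2*(m+1)+1) = {0..<5 * int (m+1)} \<union>
        (if dev Q (m+1+1) < 0 then {5 * int (m+1)} else {}) \<union>
        (\<lambda>k. entry_c (Q k)) ` {m+1<..2*(m+1)}"
      unfolding new image_insert co ce R_def[symmetric]
      using used3 by (simp add: e_def x_def algebra_simps numeral_3_eq_3)
  qed
qed


section \<open>Evolution of the deviations from a settled state\<close>

definition greedy_from :: "(nat \<Rightarrow> column) \<Rightarrow> nat \<Rightarrow> bool" where
  "greedy_from Q m\<^sub>0 \<longleftrightarrow> 3 \<le> m\<^sub>0 \<and> settled Q m\<^sub>0 \<and> (\<forall>n>2*m\<^sub>0. Q n = next_column n (used Q n))"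

lemma greedy_from_settled:
  assumes "greedy_from Q m\<^sub>0" "m\<^sub>0 \<le> m"
  shows "settled Q m"
  using assms(2)
proof (induction m rule: dec_induct)
  case base
  then show ?case using assms(1) by (simp add: greedy_from_def)
next
  case (step m)
  then show ?case using assms(1) settled_step(3)[of Q m] by (simp add: greedy_from_def)
qed

lemma greedy_from_columns:
  assumes "greedy_from Q m\<^sub>0" "m\<^sub>0 \<le> m"
  shows "Q (2*m+1) = odd_column m (dev Q (m+1))"
    and "Q (2*m+2) = even_column m (dev Q (m+2))"
  using assms settled_step(1,2)[OF greedy_from_settled[OF assms]]
  by (simp_all add: greedy_from_def)

lemma greedy_from_dev:
  assumes "greedy_from Q m\<^sub>0" "m\<^sub>0 \<le> m"
  shows "dev Q (2*m+1) = max 0 (dev Q (m+1))" and "dev Q (2*m) = min 0 (dev Q (m+1))"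
proof -
  have st: "settled Q m" and m: "3 \<le> m"
    using assms greedy_from_settled[OF assms] by (auto simp: greedy_from_def)
  then have "\<bar>dev Q (m+1)\<bar> \<le> 2" by (simp add: settled_def)
  then show "dev Q (2*m+1) = max 0 (dev Q (m+1))"
    unfolding dev_def[of _ "2*m+1"] greedy_from_columns(1)[OF assms]
    by (auto simp: odd_column_def Let_def)
  show "dev Q (2*m) = min 0 (dev Q (m+1))" using st by (simp add: settled_def)
qed

text \<open>An index \<open>k\<close> beyond \<open>2*m\<^sub>0\<close> is reduced to
  \<open>k div 2 + 1\<close>, which is smaller than \<open>k\<close> and still beyond
  \<open>m\<^sub>0\<close>. The function \<open>g\<close> stands for the deviations of another
  partition, or for the constant 0 of the standard one.\<close>

lemma greedy_from_dev_determined: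
  assumes "greedy_from Q m\<^sub>0"
    and init: "\<forall>k\<in>{m\<^sub>0<..2*m\<^sub>0}. dev Q k = g k"
    and odd: "\<And>m. m\<^sub>0 \<le> m \<Longrightarrow> g (2*m+1) = max 0 (g (m+1))"
    and even: "\<And>m. m\<^sub>0 \<le> m \<Longrightarrow> g (2*m) = min 0 (g (m+1))"
    and "m\<^sub>0 < k"
  shows "dev Q k = g k"
  using \<open>m\<^sub>0 < k\<close>
proof (induction k rule: less_induct)
  case (less k)
  have m0: "3 \<le> m\<^sub>0" using assms(1) by (simp add: greedy_from_def)
  show ?case
  proof (cases "k \<le> 2*m\<^sub>0")
    case True then show ?thesis using init less.prems by simp
  next
    case False
    define m where "m = k div 2"
    have m: "m\<^sub>0 \<le> m" "k = 2*m \<or> k = 2*m+1" using False by (auto simp: m_def)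
    then have "dev Q (m+1) = g (m+1)" using m0 by (intro less.IH) auto
    then show ?thesis
      using m(2) greedy_from_dev[OF assms(1) m(1)] odd[OF m(1)] even[OF m(1)] by auto
  qed
qed

section \<open>The partition property by counting\<close>

text \<open>Undisturbed values are at least 5 apart, and two deviations together make up at most
  4.\<close>

lemma settled_less:
  assumes "settled Q m" "k \<in> {m<..2*m}" "l \<in> {m<..2*m}" "k < l"
  shows "entry_c (Q k) < entry_c (Q l)"
proof -
  have "\<bar>dev Q k\<bar> \<le> 2" "\<bar>dev Q l\<bar> \<le> 2" using assms by (auto simp: settled_def)
  then show ?thesis using \<open>k < l\<close> by (simp add: dev_def)
qed

text \<open>Since \<open>2m\<close> columns have \<open>6m\<close> entries, this count shows that no entry is repeated.\<close>

lemma card_used: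
  assumes st: "settled Q m" and m: "1 \<le> m"
  shows "card (used Q (2*m+1)) = 6 * m"
proof -
  let ?c = "\<lambda>k. entry_c (Q k)"
  have inj: "inj_on ?c {m<..2*m}"
    by (rule linorder_inj_onI') (use settled_less[OF st] in \<open>metis less_irrefl\<close>)
  have low: "5 * int (k - 1) - 2 \<le> ?c k" if "k \<in> {m<..2*m}" for k
  proof -
    have "\<bar>dev Q k\<bar> \<le> 2" using st that by (auto simp: settled_def)
    then show ?thesis using that by (simp add: dev_def of_nat_diff)
  qed
  show ?thesis
  proof (cases "dev Q (m+1) < 0")
    case True
    \<comment> \<open>A negative deviation puts the first \<open>c\<close> inside the interval, and
      the extra number \<open>5 * int m\<close> makes up for the loss:
      \<open>(5*m + 1) + (m - 1) = 6*m\<close>.\<close>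
    have "?c (m+1) \<in> {0..5 * int m}" using True low[of "m+1"] m by (simp add: dev_def)
    moreover have "{m<..2*m} = insert (m+1) {m+1<..2*m}" using m by auto
    ultimately have "used Q (2*m+1) = {0..5 * int m} \<union> ?c ` {m+1<..2*m}"
      using st True m unfolding settled_def by auto
    moreover have "5 * int m < ?c k" if "k \<in> {m+1<..2*m}" for k
      using low[of k] that by (simp add: of_nat_diff)
    then have "{0..5 * int m} \<inter> ?c ` {m+1<..2*m} = {}" by force
    moreover have "card (?c ` {m+1<..2*m}) = m - 1"
      by (subst card_image) (auto intro: inj_on_subset[OF inj])
    ultimately show ?thesis using m by (simp add: card_Un_disjoint nat_add_distrib)
  next
    case False
    have "5 * int m \<le> ?c k" if "k \<in> {m<..2*m}" for k
    proof (cases "k = m + 1")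
      case True then show ?thesis using False by (simp add: dev_def)
    next
      case False then show ?thesis using low[OF that] that by (simp add: of_nat_diff)
    qed
    then have "{0..<5 * int m} \<inter> ?c ` {m<..2*m} = {}" by force
    moreover have "used Q (2*m+1) = {0..<5 * int m} \<union> ?c ` {m<..2*m}"
      using st False unfolding settled_def by auto
    ultimately show ?thesis by (simp add: card_Un_disjoint card_image[OF inj])
  qed
qed

text \<open>Indexing by column and row turns injectivity of the three rows and their disjointness
  into one injectivity statement, to which a cardinality argument applies.\<close>

definition entry :: "(nat \<Rightarrow> column) \<Rightarrow> nat \<times> nat \<Rightarrow> int" where
  "entry Q = (\<lambda>(k, i). [entry_a (Q k), entry_b (Q k), entry_c (Q k)] ! i)"

lemma used_eq_entry_image: "used Q n = entry Q ` ({1..<n} \<times> {..<3})"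
  by (force simp: used_def entries_def entry_def numeral_3_eq_3 lessThan_Suc)

lemma is_partitionI:
  assumes inj: "inj_on (entry Q) ({1..} \<times> {..<3})"
    and img: "entry Q ` ({1..} \<times> {..<3}) = {0..}"
  shows "is_partition Q"
proof -
  have D: "(k, i) = (l, j)" if "entry Q (k, i) = entry Q (l, j)" "1 \<le> k" "1 \<le> l" "i < 3" "j < 3"
    for k l i j
    using inj_onD[OF inj that(1)] that by auto
  have D': "entry Q (k, i) \<noteq> entry Q (l, j)" if "i < 3" "j < 3" "i \<noteq> j" "1 \<le> k" "1 \<le> l" for i j k l
    using D that by blast
  have e: "entry_a (Q k) = entry Q (k, 0)" "entry_b (Q k) = entry Q (k, 1)"
    "entry_c (Q k) = entry Q (k, 2)" for k
    by (simp_all add: entry_def)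
  have "{0..} = (\<Union>i\<in>{..<3}. (\<lambda>k. entry Q (k, i)) ` {1..})"
    unfolding img[symmetric] by blast
  moreover have "{..<3} = {0, 1, 2::nat}" by auto
  ultimately have "(\<lambda>k. entry Q (k, 0)) ` {1..} \<union> (\<lambda>k. entry Q (k, 1)) ` {1..}
      \<union> (\<lambda>k. entry Q (k, 2)) ` {1..} = {0..}"
    by (simp add: Un_assoc)
  moreover have "inj_on (\<lambda>k. entry Q (k, i)) {1..}" if "i < 3" for i
    using D that by (auto intro!: inj_onI)
  moreover have "(\<lambda>k. entry Q (k, i)) ` {1..} \<inter> (\<lambda>k. entry Q (k, j)) ` {1..} = {}"
    if "i < 3" "j < 3" "i \<noteq> j" for i j
    using D'[OF that] by fastforce
  ultimately show ?thesis
    unfolding is_partition_def Let_def e by simp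
qed

text \<open>By \<open>card_used\<close> the \<open>6*m\<close> positions in the first
  \<open>2*m\<close> columns carry \<open>6*m\<close> values, so \<open>entry\<close> is injective
  there, and any two positions lie in such a segment. Every number occurs because
  \<open>settled\<close> puts all of \<open>{0..<5 * int m}\<close> among the used ones.\<close>

lemma greedy_from_is_partition:
  assumes gr: "greedy_from Q m\<^sub>0"
  shows "is_partition Q"
proof (rule is_partitionI)
  have m0: "3 \<le> m\<^sub>0" using gr by (simp add: greedy_from_def)
  have inj: "inj_on (entry Q) ({1..<2*m+1} \<times> {..<3})" if "m\<^sub>0 \<le> m" for m
    using card_used[OF greedy_from_settled[OF gr that]] that m0
    by (intro eq_card_imp_inj_on) (auto simp: used_eq_entry_image card_cartesian_product)
  show "inj_on (entry Q) ({1..} \<times> {..<3})"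
  proof (rule inj_onI)
    fix p q assume pq: "p \<in> {1..} \<times> {..<3}" "q \<in> {1..} \<times> {..<3}" "entry Q p = entry Q q"
    show "p = q"
      by (rule inj_onD[OF inj[of "m\<^sub>0 + fst p + fst q"] pq(3)]) (use pq in auto)
  qed
  show "entry Q ` ({1..} \<times> {..<3}) = {0..}"
  proof (intro equalityI subsetI)
    fix y assume "y \<in> entry Q ` ({1..} \<times> {..<3})"
    then obtain k i where ki: "1 \<le> k" "i < 3" "y = entry Q (k, i)" by auto
    define m where "m = m\<^sub>0 + k"
    have st: "settled Q m" by (rule greedy_from_settled[OF gr]) (simp add: m_def)
    have "y \<in> used Q (2*m+1)"
      unfolding used_eq_entry_image ki(3) using ki by (intro imageI) (auto simp: m_def)
    moreover have "0 \<le> entry_c (Q l)" if "l \<in> {m<..2*m}" for l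
    proof -
      have "\<bar>dev Q l\<bar> \<le> 2" using st that by (auto simp: settled_def)
      moreover have "2 \<le> l" using that ki by (simp add: m_def)
      ultimately show ?thesis by (simp add: dev_def)
    qed
    ultimately show "y \<in> {0..}" using st by (auto simp: settled_def split: if_splits)
  next
    fix y :: int assume y: "y \<in> {0..}"
    define m where "m = m\<^sub>0 + nat y + 1"
    have "settled Q m" by (rule greedy_from_settled[OF gr]) (simp add: m_def)
    then have "y \<in> used Q (2*m+1)" using y by (auto simp: settled_def m_def)
    then show "y \<in> entry Q ` ({1..} \<times> {..<3})"
      unfolding used_eq_entry_image by (rule rev_subsetD) (auto intro!: image_mono)
  qed
qed

section \<open>Equivalence decided by the deviations\<close>

text \<open>Equal deviations in the window propagate forever and fix all later columns. Conversely,
  a difference at one index causes a difference at a larger one, so the last entries disagree at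
  arbitrarily large indices.\<close>

lemma greedy_from_equiv_iff:
  assumes Q: "greedy_from Q m\<^sub>0" and R: "greedy_from R m\<^sub>0"
  shows "(Q, R) \<in> partition_equiv \<longleftrightarrow> (\<forall>k\<in>{m\<^sub>0<..2*m\<^sub>0}. dev Q k = dev R k)"
proof
  assume init: "\<forall>k\<in>{m\<^sub>0<..2*m\<^sub>0}. dev Q k = dev R k"
  have dev: "dev Q k = dev R k" if "m\<^sub>0 < k" for k
    by (rule greedy_from_dev_determined[OF Q init _ _ that]) (rule greedy_from_dev[OF R], assumption)+
  have "Q k = R k" if "2*m\<^sub>0 < k" for k
  proof -
    define m where "m = (k - 1) div 2"
    have m: "m\<^sub>0 \<le> m" "k = 2*m+1 \<or> k = 2*m+2" using that by (auto simp: m_def)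
    then show ?thesis
      using greedy_from_columns[OF Q m(1)] greedy_from_columns[OF R m(1)] dev[of "m+1"] dev[of "m+2"]
      by auto
  qed
  then show "(Q, R) \<in> partition_equiv"
    using greedy_from_is_partition[OF Q] greedy_from_is_partition[OF R]
    by (auto simp: partition_equiv_def intro!: exI[of _ "2*m\<^sub>0"])
next
  assume "(Q, R) \<in> partition_equiv"
  then obtain N where N: "\<And>k. N < k \<Longrightarrow> entry_c (Q k) = entry_c (R k)"
    by (auto simp: partition_equiv_def)
  show "\<forall>k\<in>{m\<^sub>0<..2*m\<^sub>0}. dev Q k = dev R k"
  proof (rule ccontr)
    assume "\<not> ?thesis"
    then obtain k where k: "m\<^sub>0 < k" "dev Q k \<noteq> dev R k" by auto
    have m0: "3 \<le> m\<^sub>0" using Q by (simp add: greedy_from_def)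
    have "\<exists>l. N' < l \<and> m\<^sub>0 < l \<and> dev Q l \<noteq> dev R l" for N'
    proof (induction N')
      case 0 show ?case using k by (intro exI[of _ k]) auto
    next
      case (Suc N')
      then obtain l where l: "N' < l" "m\<^sub>0 < l" "dev Q l \<noteq> dev R l" by blast
      define m where "m = l - 1"
      have m: "m\<^sub>0 \<le> m" "l = m + 1" using l by (auto simp: m_def)
      \<comment> \<open>A number is the sum of its \<open>max 0\<close> and \<open>min 0\<close>
        parts, so unequal numbers differ in one of them.\<close>
      have "dev Q (2*m+1) \<noteq> dev R (2*m+1) \<or> dev Q (2*m) \<noteq> dev R (2*m)"
        using greedy_from_dev[OF Q m(1)] greedy_from_dev[OF R m(1)] l(3) m(2) by auto
      moreover have "Suc N' < 2*m" "m\<^sub>0 < 2*m" using l m m0 by auto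
      ultimately show ?case by (metis less_SucI Suc_eq_plus1)
    qed
    then show False using N by (metis dev_def)
  qed
qed

section \<open>The standard partition\<close>

lemma standard_partition_eq:
  "standard_partition n = (3 * int n - int n div 2 - 2, 3 * int n - int n div 2 - 1, 5 * int n - 5)"
  using floor_divide_of_nat_eq[of n 2, where 'a=real]
  by (simp add: standard_partition_def zdiv_int)

lemma standard_partition_odd_even:
  "standard_partition (2*m+1) = odd_column m 0" "standard_partition (2*m+2) = even_column m 0"
  by (simp_all add: standard_partition_eq odd_column_def even_column_def Let_def)

text \<open>Residues modulo 5 separate the rows: 1 or 3 in the first, 2 or 4 in the second, 0 in the
  third. Within a row, the enumeration is strictly increasing.\<close>

lemma is_partition_standard: "is_partition standard_partition"
proof -
  define f :: "int \<Rightarrow> int" where "f k = 3*k - k div 2" for k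
  have f_even: "f (2*p) = 5*p" and f_odd: "f (2*p+1) = 5*p + 3" for p
    by (simp_all add: f_def)
  have f_mod: "f k mod 5 = 0 \<or> f k mod 5 = 3" for k
    by (cases "even k") (auto elim!: evenE oddE simp: f_even f_odd)
  have "f k < f l" if "k < l" for k l
    using that unfolding f_def by linarith
  then have pair: "f k = f l \<longleftrightarrow> k = l" for k l
    by (metis less_irrefl linorder_neqE)
  have disjoint: "f k - 2 \<noteq> f l - 1" "f k - 2 \<noteq> 5*l - 5" "f k - 1 \<noteq> 5*l - 5" for k l
  proof -
    have ne: "x - 2 \<noteq> y - 1" "x - 2 \<noteq> 5*l - 5" "x - 1 \<noteq> 5*l - 5"
      if "x mod 5 = 0 \<or> x mod 5 = 3" "y mod 5 = 0 \<or> y mod 5 = 3" for x y :: int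
      using that by presburger+
    show "f k - 2 \<noteq> f l - 1" "f k - 2 \<noteq> 5*l - 5" "f k - 1 \<noteq> 5*l - 5"
      by (rule ne[OF f_mod f_mod])+
  qed
  have cover: "\<exists>k\<ge>1. y = f (int k) - 2 \<or> y = f (int k) - 1
      \<or> y = 5 * int k - 5" if "0 \<le> y" for y
  proof -
    define m r where "m = nat (y div 5)" and "r = y mod 5"
    have y: "y = 5 * int m + r" "r \<in> {0, 1, 2, 3, 4}"
      using that by (auto simp: m_def r_def)
    \<comment> \<open>The residue tells the column: \<open>m+1\<close> through its last entry for 0,
      \<open>2*m+1\<close> for 1 and 2, \<open>2*m+2\<close> for 3 and 4.\<close>
    consider "r = 0" | "r \<in> {1, 2}" | "r \<in> {3, 4}" using y(2) by auto
    then show ?thesis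
    proof cases
      case 1 then show ?thesis using y by (intro exI[of _ "m+1"]) (auto simp: f_def)
    next
      case 2 then show ?thesis using y by (intro exI[of _ "2*m+1"]) (auto simp: f_def)
    next
      case 3 then show ?thesis using y by (intro exI[of _ "2*m+2"]) (auto simp: f_def)
    qed
  qed
  have nonneg: "0 \<le> f (int k) - 2" if "1 \<le> k" for k
    using that unfolding f_def by linarith
  show ?thesis
    unfolding is_partition_def Let_def standard_partition_eq entry_a.simps entry_b.simps entry_c.simps f_def[symmetric]
  proof (intro conjI)
    show "inj_on (\<lambda>k. f (int k) - 2) {1..}"
      by (rule inj_onI) (simp add: pair)
    show "inj_on (\<lambda>k. f (int k) - 1) {1..}"
      by (rule inj_onI) (simp add: pair)
    show "inj_on (\<lambda>k. 5 * int k - 5) {1..}" by (rule inj_onI) simp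
    show "(\<lambda>k. f (int k) - 2) ` {1..} \<union> (\<lambda>k. f (int k) - 1) ` {1..} \<union>
        (\<lambda>k. 5 * int k - 5) ` {1..} = {0..}" (is "?L = _")
    proof (intro equalityI subsetI)
      fix y assume "y \<in> ?L"
      then show "y \<in> {0..}" using nonneg by fastforce
    next
      fix y :: int assume "y \<in> {0..}"
      then show "y \<in> ?L" using cover[of y] by auto
    qed
  qed (use disjoint in \<open>blast+\<close>)
qed

text \<open>The constant 0 satisfies the recursion for deviations, and columns with deviation 0 are
  the standard ones. Comparing columns directly avoids a proof that the standard partition is
  greedy.\<close>

lemma greedy_from_equiv_standard:
  assumes Q: "greedy_from Q m\<^sub>0" and zero: "\<forall>k\<in>{m\<^sub>0<..2*m\<^sub>0}. dev Q k = 0"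
  shows "(Q, standard_partition) \<in> partition_equiv"
proof -
  have dev: "dev Q k = 0" if "m\<^sub>0 < k" for k
    using greedy_from_dev_determined[OF Q zero _ _ that] by simp
  have "Q k = standard_partition k" if "2*m\<^sub>0 < k" for k
  proof -
    define m where "m = (k - 1) div 2"
    have m: "m\<^sub>0 \<le> m" "k = 2*m+1 \<or> k = 2*m+2" using that by (auto simp: m_def)
    then show ?thesis
      using greedy_from_columns[OF Q m(1)] dev[of "m+1"] dev[of "m+2"] standard_partition_odd_even[of m]
      by auto
  qed
  then show ?thesis
    using greedy_from_is_partition[OF Q] is_partition_standard
    by (auto simp: partition_equiv_def intro!: exI[of _ "2*m\<^sub>0"])
qed

section \<open>Executable simulation of the algorithm\<close>

text \<open>The set of used numbers is represented as \<open>{0..<p} \<union> set xs\<close>; \<open>fill\<close> makes \<open>p\<close> maximal.\<close>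

fun fill :: "int \<Rightarrow> int list \<Rightarrow> int \<times> int list" where
  "fill p xs = (if p \<in> set xs then fill (p + 1) (removeAll p xs) else (p, xs))"

declare fill.simps [simp del]

text \<open>Each step moves \<open>p\<close> from the list into the interval, so the represented set
  is unchanged; the final \<open>q\<close> is its least missing non-negative number.\<close>

lemma fill_least_unused:
  assumes "fill p xs = (q, ys)" "0 \<le> p"
  shows "{0..<p} \<union> set xs = {0..<q} \<union> set ys" and "q \<notin> set ys" and "0 \<le> q" and "p \<le> q"
proof -
  have "{0..<p} \<union> set xs = {0..<q} \<union> set ys \<and> q \<notin> set ys \<and> p \<le> q"
    using assms
  proof (induction p xs rule: fill.induct)
    case (1 p xs)
    show ?case
    proof (cases "p \<in> set xs")
      case True
      then have "{0..<p+1} \<union> set (removeAll p xs) = {0..<q} \<union> set ys \<and> q \<notin> set ys \<and> p + 1 \<le> q"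
        using 1 by (simp add: fill.simps[of p])
      moreover have "{0..<p+1} \<union> set (removeAll p xs) = {0..<p} \<union> set xs"
      proof -
        have "{0..<p+1} = insert p {0..<p}" using \<open>0 \<le> p\<close> by auto
        then show ?thesis using True by auto
      qed
      ultimately show ?thesis by simp
    next
      case False then show ?thesis using 1 by (simp add: fill.simps[of p])
    qed
  qed
  then show "{0..<p} \<union> set xs = {0..<q} \<union> set ys" "q \<notin> set ys" "0 \<le> q" "p \<le> q"
    using assms(2) by auto
qed

text \<open>The greedy rule in executable form. The second \<open>fill\<close> starts at
  \<open>a + 1\<close> because \<open>a\<close> has just been used. Only the last entries are
  recorded, as they alone enter the deviations.\<close>

fun simulate :: "nat \<Rightarrow> int \<Rightarrow> int \<Rightarrow> int list \<Rightarrow> int list \<times> int \<times> int list" where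
  "simulate 0 n p xs = ([], p, xs)"
| "simulate (Suc k) n p xs =
    (let (a, ys) = fill p xs; (b, zs) = fill (a + 1) ys; c = 11 * n - 2 * (n div 2) - 8 - a - b;
       (cs, r) = simulate k (n + 1) (b + 1) (c # zs)
     in (c # cs, r))"

lemma simulate:
  assumes "simulate k (int n) p xs = (cs, q, ys)" and "1 \<le> n" "0 \<le> p"
    and "used Q n = {0..<p} \<union> set xs"
    and "\<And>l. n \<le> l \<Longrightarrow> Q l = next_column l (used Q l)"
  shows "map (\<lambda>l. entry_c (Q l)) [n..<n+k] = cs \<and> used Q (n+k) = {0..<q} \<union> set ys"
  using assms
proof (induction k arbitrary: n p xs cs)
  case 0 then show ?case by simp
next
  case (Suc k)
  obtain a us where f1: "fill p xs = (a, us)" by fastforce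
  obtain b vs where f2: "fill (a + 1) us = (b, vs)" by fastforce
  define c where "c = 11 * int n - 2 * (int n div 2) - 8 - a - b"
  obtain cs' r where sim': "simulate k (int n + 1) (b + 1) (c # vs) = (cs', r)"
    by (rule prod.exhaust)
  have "cs = c # cs'" "r = (q, ys)"
    using Suc.prems(1) sim' by (simp_all add: f1 f2 c_def Let_def)
  then have sim: "simulate k (int (Suc n)) (b + 1) (c # vs) = (cs', q, ys)" "cs = c # cs'"
    using sim' by (simp_all add: add.commute)
  note F1 = fill_least_unused[OF f1 \<open>0 \<le> p\<close>]
  have a1: "0 \<le> a + 1" using F1(3) by simp
  note F2 = fill_least_unused[OF f2 a1]
  have U: "used Q n = {0..<a} \<union> set us" using Suc.prems(4) F1(1) by simp
  have "insert a (used Q n) = {0..<a+1} \<union> set us" using U F1(3) by auto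
  then have U': "insert a (used Q n) = {0..<b} \<union> set vs" using F2(1) by simp
  have "least_unused (used Q n) = a"
    by (rule least_unused_eqI) (use U F1 in auto)
  moreover have "least_unused (insert a (used Q n)) = b"
    by (rule least_unused_eqI) (use U' F2 in auto)
  ultimately have Qn: "Q n = (a, b, c)"
    using Suc.prems(5)[of n] by (simp add: next_column_def S_eq c_def)
  have "used Q (Suc n) = insert b (insert c (insert a (used Q n)))"
    using used_Suc[OF \<open>1 \<le> n\<close>] by (auto simp: Qn entries_def)
  also have "\<dots> = {0..<b+1} \<union> set (c # vs)" unfolding U' using F2(3) by auto
  finally have "map (\<lambda>l. entry_c (Q l)) [Suc n..<Suc n+k] = cs' \<and> used Q (Suc n+k) = {0..<q} \<union> set ys"
    using F2(3) Suc.prems(5) by (intro Suc.IH[OF sim(1)]) auto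
  moreover have "[n..<n + Suc k] = n # [Suc n..<Suc n+k]" by (simp add: upt_conv_Cons del: upt_Suc)
  ultimately show ?case by (simp add: sim(2) Qn del: upt_Suc)
qed

section \<open>Deviation windows of the twenty partitions\<close>

definition window :: "(nat \<Rightarrow> column) \<Rightarrow> int list" where
  "window Q = map (dev Q) [8..<15]"

text \<open>The values claimed for \<open>P 1\<close> to \<open>P 20\<close> in this order, to be
  confirmed by evaluation; \<open>u\<close> and \<open>v\<close> belong to the two classes with
  several members.\<close>

definition windows :: "int list list" where
  "windows =
    (let u = [-1, 0, 0, 1, 0, 0, -1]; v = [-2, 0, 0, 2, 0, 0, -2]
     in [u, v, v, v, v, [0, 2, -2, 0, 0, 0, 0], [0, 0, 0, 0, 0, 0, 0], [-2, 0, 0, 1, 0, 1, -2], v, v,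
         [0, 1, -1, 0, 0, 0, 0], [-1, 0, 0, 0, 0, 1, -1], [-2, 0, 0, 0, 0, 2, -2], v, v, v, v, u, v, v])"

definition column_list :: "column \<Rightarrow> int list" where
  "column_list x = [entry_a x, entry_b x, entry_c x]"

text \<open>An executable test for \<open>settled\<close> at \<open>m = 7\<close>. Nine simulated
  columns are 6 to 14, and dropping two leaves 8 to 14. So \<open>hd ds\<close> and
  \<open>last ds\<close> are the deviations at \<open>m+1\<close> and \<open>2*m\<close>, and
  \<open>35 = 5*m\<close>.\<close>

definition settles :: "column list \<Rightarrow> int list \<Rightarrow> bool" where
  "settles cs ds =
    (let (es, q, ys) = simulate 9 6 0 (concat (map column_list cs)); fs = drop 2 es
     in length cs = 5 \<and> map2 (\<lambda>c k. c - 5 * (k - 1)) fs [8..14] = ds \<and>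
        (\<forall>d\<in>set ds. \<bar>d\<bar> \<le> 2) \<and> last ds = min 0 (hd ds) \<and>
        set ([0..q-1] @ ys) = set ((if hd ds < 0 then [35] else []) @ [0..34] @ fs))"

lemma settles_columns:
  "list_all2 (\<lambda>cs ds. settles ([(0,1,2), (3,4,5)] @ cs) ds) columns_3_4_5 windows"
  by code_simp


lemma algorithm_greedy:
  assumes "settles cs ds"
  shows "greedy_from (algorithm cs) 7" and "window (algorithm cs) = ds"
proof -
  let ?Q = "algorithm cs"
  define fs where "fs = map (\<lambda>l. entry_c (?Q l)) [8..<15]"
  obtain es q ys where sim: "simulate 9 (int 6) 0 (concat (map column_list cs)) = (es, q, ys)"
    by (rule prod_cases3)
  have len: "length cs = 5" using assms by (simp add: settles_def Let_def split: prod.splits)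
  have "?Q ` {1..<6} = set cs"
  proof -
    have "?Q ` {1..<6} = (\<lambda>n. cs ! (n - 1)) ` {1..<6}"
      by (intro image_cong refl) (subst algorithm.simps, simp)
    also have "\<dots> = (!) cs ` (\<lambda>n. n - 1) ` {1..<6}" by (simp add: image_image)
    also have "(\<lambda>n. n - 1) ` {1..<6} = {0..<5::nat}" by (force intro: image_eqI[of _ _ "Suc _"])
    finally show ?thesis using nth_image[of 5 cs] by (simp add: len)
  qed
  \<comment> \<open>The interval is empty at first: all given entries start in the list, and
    \<open>fill\<close> absorbs their initial run.\<close>
  then have init: "used ?Q 6 = {0..<0} \<union> set (concat (map column_list cs))"
    by (auto simp: used_def column_list_def entries_def)
  have next_col: "?Q l = next_column l (used ?Q l)" if "6 \<le> l" for l
    using that by (subst algorithm.simps) (simp add: used_def)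
  have "map (\<lambda>l. entry_c (?Q l)) [6..<6+9] = es \<and> used ?Q (6+9) = {0..<q} \<union> set ys"
    by (rule simulate[OF sim _ _ init]) (auto intro: next_col)
  moreover have "drop 2 [6..<15] = [8..<15]" by simp
  ultimately have es: "drop 2 es = fs" and used: "used ?Q 15 = {0..<q} \<union> set ys"
    by (auto simp: fs_def simp flip: drop_map)
  have ds: "ds = map2 (\<lambda>c k. c - 5 * (k - 1)) fs [8..14]" "\<forall>d\<in>set ds. \<bar>d\<bar> \<le> 2"
    "last ds = min 0 (hd ds)"
    "set ([0..q-1] @ ys) = set ((if hd ds < 0 then [35] else []) @ [0..34] @ fs)"
    using assms sim by (simp_all add: settles_def es)
  show win: "window ?Q = ds"
    unfolding ds(1) fs_def window_def dev_def by (simp add: upt_rec upto_rec1)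
  have "used ?Q 15 = {0..<35} \<union> (if hd ds < 0 then {35} else {}) \<union> set fs"
  proof -
    have "{0..<q} = set [0..q-1]" "{0..<35::int} = set [0..34]" by auto
    then show ?thesis using used ds(4) by (simp only: set_append) (simp split: if_splits)
  qed
  moreover have "hd ds = dev ?Q 8" "last ds = dev ?Q 14"
    unfolding win[symmetric] window_def by (simp_all add: upt_rec)
  moreover have "set ds = dev ?Q ` {8..<15}"
    unfolding win[symmetric] window_def by (simp only: set_map set_upt)
  moreover have "set fs = (\<lambda>l. entry_c (?Q l)) ` {8..<15}"
    unfolding fs_def by (simp only: set_map set_upt)
  moreover have "{7<..14} = {8..<15::nat}" by auto
  ultimately have "settled ?Q 7"
    using ds(2,3) by (simp add: settled_def)
  then show "greedy_from ?Q 7" using next_col by (simp add: greedy_from_def)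
qed

lemma settles_P:
  assumes "i \<in> {1..20}"
  shows "greedy_from (P i) 7" and "window (P i) = windows ! (i - 1)"
proof -
  have "length columns_3_4_5 = 20" by (simp add: columns_3_4_5_def)
  then have "settles ([(0,1,2), (3,4,5)] @ columns_3_4_5 ! (i - 1)) (windows ! (i - 1))"
    using list_all2_nthD[OF settles_columns, of "i - 1"] assms by auto
  then show "greedy_from (P i) 7" and "window (P i) = windows ! (i - 1)"
    unfolding P_def by (rule algorithm_greedy)+
qed

lemma P_equiv_iff:
  assumes "i \<in> {1..20}" "j \<in> {1..20}"
  shows "(P i, P j) \<in> partition_equiv \<longleftrightarrow> windows ! (i - 1) = windows ! (j - 1)"
proof -
  have "{7<..2*7} = set [8..<15::nat]" by auto
  then show ?thesis
    unfolding greedy_from_equiv_iff[OF settles_P(1)[OF assms(1)] settles_P(1)[OF assms(2)]]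
      settles_P(2)[OF assms(1), symmetric] settles_P(2)[OF assms(2), symmetric]
    by (simp only: window_def map_eq_conv)
qed

section \<open>The eight equivalence classes\<close>

definition indices :: "int list \<Rightarrow> nat list" where
  "indices ds = map fst (filter (\<lambda>(j, es). es = ds) (zip [1..<21] windows))"

lemma length_windows: "length windows = 20"
  by (simp add: windows_def Let_def)

lemma set_indices: "set (indices ds) = {j \<in> {1..20}. windows ! (j - 1) = ds}"
proof (intro equalityI subsetI)
  fix j assume "j \<in> set (indices ds)"
  then show "j \<in> {j \<in> {1..20}. windows ! (j - 1) = ds}"
    by (auto simp: indices_def set_zip length_windows)
next
  fix j assume j: "j \<in> {j \<in> {1..20}. windows ! (j - 1) = ds}"
  then have "(j, ds) \<in> set (zip [1..<21] windows)"
    unfolding set_zip by (auto simp: length_windows intro!: exI[of _ "j - 1"])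
  then show "j \<in> set (indices ds)" by (force simp: indices_def)
qed

text \<open>Since \<open>remdups\<close> keeps last occurrences, the classes of \<open>P 1\<close>
  and \<open>P 2\<close> come at the end.\<close>

lemma indices_windows:
  "remdups (map indices windows) =
    [[6], [7], [8], [11], [12], [13], [1,18], [2,3,4,5,9,10,14,15,16,17,19,20]]"
  by code_simp

text \<open>By \<open>P_equiv_iff\<close> the class of \<open>P i\<close> consists of all
  \<open>P j\<close> with the same window, and \<open>indices\<close> lists these \<open>j\<close>.
  The list without repetitions also yields the upper bound on the number of classes.\<close>

lemma quotient_P_eq_image:
  "(P ` {1..20}) // Restr partition_equiv (P ` {1..20}) =
    (\<lambda>js. P ` set js) ` set (remdups (map indices windows))"
proof -
  have "(!) windows ` {0..<20} = set windows"
    using nth_image[of 20 windows] by (simp add: length_windows)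
  moreover have "{0..<20} = (\<lambda>i. i - 1) ` {1..20::nat}"
    by (force intro: image_eqI[of _ _ "Suc _"])
  ultimately have windows: "(\<lambda>i. windows ! (i - 1)) ` {1..20} = set windows"
    by (simp only: image_image)
  have "(Restr partition_equiv (P ` {1..20})) `` {P i} = P ` set (indices (windows ! (i - 1)))"
    if "i \<in> {1..20}" for i
    using P_equiv_iff[OF that] that unfolding set_indices by fastforce
  then have "P ` {1..20} // Restr partition_equiv (P ` {1..20})
      = (\<lambda>i. P ` set (indices (windows ! (i - 1)))) ` {1..20}"
    unfolding quotient_def by auto
  also have "\<dots> = (\<lambda>js. P ` set js) ` set (remdups (map indices windows))"
    by (simp only: set_remdups set_map windows[symmetric] image_image)
  finally show ?thesis .
qed

lemma quotient_P:
  "P ` {1..20} // Restr partition_equiv (P ` {1..20}) =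
      {{P 1, P 18},
       {P 2, P 3, P 4, P 5, P 9, P 10, P 14, P 15, P 16, P 17, P 19, P 20},
       {P 6}, {P 7}, {P 8}, {P 11}, {P 12}, {P 13}}"
  unfolding quotient_P_eq_image indices_windows
  \<comment> \<open>The two enumerations differ only in order, so inclusion both ways follows by
    reflexivity, without deciding any equation between different \<open>P i\<close>.\<close>
  by (simp only: list.simps image_insert image_empty)
    (rule equalityI; simp only: insert_subset empty_subsetI insert_iff simp_thms)

theorem proposition2p1:
  shows "(\<forall>i\<in>{1..20}. is_partition (P i)) \<and>
    P ` {1..20} // Restr partition_equiv (P ` {1..20}) =
      {{P 1, P 18},
       {P 2, P 3, P 4, P 5, P 9, P 10, P 14, P 15, P 16, P 17, P 19, P 20},
       {P 6}, {P 7}, {P 8}, {P 11}, {P 12}, {P 13}} \<and>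
    card (P ` {1..20} // Restr partition_equiv (P ` {1..20})) = 8 \<and>
    (P 7, standard_partition) \<in> partition_equiv"
proof (intro conjI ballI)
  show "is_partition (P i)" if "i \<in> {1..20}" for i
    using greedy_from_is_partition[OF settles_P(1)[OF that]] .
  show "P ` {1..20} // Restr partition_equiv (P ` {1..20}) =
      {{P 1, P 18},
       {P 2, P 3, P 4, P 5, P 9, P 10, P 14, P 15, P 16, P 17, P 19, P 20},
       {P 6}, {P 7}, {P 8}, {P 11}, {P 12}, {P 13}}"
    by (rule quotient_P)
  \<comment> \<open>The windows of its members tell the classes apart.\<close>
  have "card ((\<lambda>X. window ` X) ` (P ` {1..20} // Restr partition_equiv (P ` {1..20}))) = 8"
    unfolding quotient_P by (simp add: settles_P(2) windows_def Let_def)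
  moreover have "finite (P ` {1..20} // Restr partition_equiv (P ` {1..20}))"
    unfolding quotient_P by simp
  ultimately have "8 \<le> card (P ` {1..20} // Restr partition_equiv (P ` {1..20}))"
    by (metis card_image_le)
  \<comment> \<open>For the upper bound, the quotient is the image of a list of length 8.\<close>
  moreover have "card (P ` {1..20} // Restr partition_equiv (P ` {1..20}))
      \<le> length (remdups (map indices windows))"
    unfolding quotient_P_eq_image by (rule order_trans[OF card_image_le card_length]) simp
  then have "card (P ` {1..20} // Restr partition_equiv (P ` {1..20})) \<le> 8"
    unfolding indices_windows by simp
  ultimately show "card (P ` {1..20} // Restr partition_equiv (P ` {1..20})) = 8" by simp
  have zero: "\<forall>k\<in>{7<..2*7}. dev (P 7) k = 0"
  proof -
    have "\<forall>d\<in>set (window (P 7)). d = 0" by (simp add: settles_P(2) windows_def Let_def)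
    moreover have "{7<..2*7} = {8..<15::nat}" by auto
    ultimately show ?thesis by (simp only: window_def set_map set_upt ball_simps)
  qed
  have "greedy_from (P 7) 7" by (rule settles_P(1)) simp
  then show "(P 7, standard_partition) \<in> partition_equiv"
    using zero by (rule greedy_from_equiv_standard)
qed

end
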